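(* Let $a\in L^\infty(0,1)$ satisfy $\int_0^1a(x)\,dx<0$ and suppose there is $z\in(0,1)$ such that $a(x)>0$ for a.e. $x\in(0,z)$ and $a(x)<0$ for a.e. $x\in(z,1)$. Let $f\in\mathcal C(\mathbb R)$ satisfy $f(0)=0$, $f(u)>0$ for $u>0$, and, for some constants $h>0$, $p>0$ and $q\in(0,1)$, $$\lim_{u\to0^+}\frac{f(u)}{u^p}=1,\qquad \lim_{u\to\infty}\frac{f(u)}{u^{-q}}=h.$$ Let $M>0$ be the maximal number with $f(M)=\max_{u\ge0}f(u)$, and suppose that $f\in\mathcal C^1[M,\infty)$, $f$ is increasing in $(0,M)$ and decreasing in $(M,\infty)$. Let $\{(\lambda_n,u_n)\}_{n\ge1}$ be a sequence such that $u_n$ is a regular positive solution of $$-\left(\frac{u'}{\sqrt{1+(u')^2}}\right)'=\lambda_n a(x)f(u),\quad 0<x<1,\qquad u'(0)=u'(1)=0,$$ with $\lim_{n\to\infty}\lambda_n=\infty$ and $\liminf_{n\to\infty}u_n(0)>0$. Then, for every $\eta\in(0,z)$, there exist a constant $C>0$ and an integer $n_0\ge1$ such that $$u_n(x)\ge C\lambda_n^{1/q}\quad\text{for all }x\in[0,z-\eta]\text{ and }n\ge n_0.$$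
   Context: A regular solution is a function $u\in W^{2,1}(0,1)$ satisfying the equation a.e. in $(0,1)$ and the boundary conditions; it is positive if $\min u\ge0$ and $\max u>0$. "Increasing" and "decreasing" for $f$ are meant in the strict sense. *)

theory Defs
  imports "HOL-Analysis.Analysis"
begin

definition Linfty_on :: "real set \<Rightarrow> (real \<Rightarrow> real) \<Rightarrow> bool" where
  "Linfty_on I a \<longleftrightarrow>
     a \<in> borel_measurable (lebesgue_on I) \<and> (\<exists>K. AE x in lebesgue_on I. \<bar>a x\<bar> \<le> K)"

definition test_fun :: "real set \<Rightarrow> (real \<Rightarrow> real) \<Rightarrow> bool" where
  "test_fun I \<phi> \<longleftrightarrow>
     \<phi> C1_differentiable_on UNIV \<and>
     compact (closure {x. \<phi> x \<noteq> 0}) \<and> closure {x. \<phi> x \<noteq> 0} \<subseteq> I"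

text \<open>
  On an open interval I: both functions lie in \<open>L\<^sup>1(I)\<close> and \<open>v'\<close> is the distributional
  derivative of \<open>v\<close>. As usual in dimension one, the test functions are of class
  \<open>C\<^sup>1\<close> with compact support, which determines the same derivative as smooth ones.
\<close>
definition has_weak_deriv :: "real set \<Rightarrow> (real \<Rightarrow> real) \<Rightarrow> (real \<Rightarrow> real) \<Rightarrow> bool" where
  "has_weak_deriv I v v' \<longleftrightarrow>
     integrable (lebesgue_on I) v \<and> integrable (lebesgue_on I) v' \<and>
     (\<forall>\<phi>. test_fun I \<phi> \<longrightarrow>
        (LINT x|lebesgue_on I. v x * deriv \<phi> x) = - (LINT x|lebesgue_on I. v' x * \<phi> x))"

definition W11 :: "real set \<Rightarrow> (real \<Rightarrow> real) \<Rightarrow> bool" where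
  "W11 I v \<longleftrightarrow> (\<exists>v'. has_weak_deriv I v v')"

definition W21 :: "real set \<Rightarrow> (real \<Rightarrow> real) \<Rightarrow> bool" where
  "W21 I v \<longleftrightarrow> (\<exists>v'. has_weak_deriv I v v' \<and> W11 I v')"

text \<open>
  Elements of \<open>W\<^sup>2\<^sup>,\<^sup>1(0,1)\<close> are identified with their representatives in
  \<open>C\<^sup>1[0,1]\<close>: \<open>u\<close> and \<open>u'\<close> below are the continuous representatives, so that their point
  values are meaningful, up to the end points. The function \<open>w\<close> is the derivative
  \<open>(u' / sqrt (1 + u'\<^sup>2))'\<close>, which is an integrable function, unique up to null sets, whenever
  \<open>u\<close> is in \<open>W\<^sup>2\<^sup>,\<^sup>1(0,1)\<close>.
\<close>
definition regular_solution ::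
    "(real \<Rightarrow> real) \<Rightarrow> (real \<Rightarrow> real) \<Rightarrow> real \<Rightarrow> (real \<Rightarrow> real) \<Rightarrow> bool" where
  "regular_solution a f l u \<longleftrightarrow>
     W21 {0<..<1} u \<and> continuous_on {0..1} u \<and>
     (\<exists>u' w. has_weak_deriv {0<..<1} u u' \<and> continuous_on {0..1} u' \<and>
        has_weak_deriv {0<..<1} (\<lambda>x. u' x / sqrt (1 + (u' x)\<^sup>2)) w \<and>
        (AE x in lebesgue_on {0<..<1}. - w x = l * a x * f (u x)) \<and>
        u' 0 = 0 \<and> u' 1 = 0)"

definition positive_on_unit :: "(real \<Rightarrow> real) \<Rightarrow> bool" where
  "positive_on_unit u \<longleftrightarrow> (\<forall>x\<in>{0..1}. 0 \<le> u x) \<and> (\<exists>x\<in>{0..1}. 0 < u x)"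

text \<open>The derivative at the end point \<open>M\<close> is one-sided.\<close>
definition C1_on_ray :: "real \<Rightarrow> (real \<Rightarrow> real) \<Rightarrow> bool" where
  "C1_on_ray M f \<longleftrightarrow>
     (\<exists>f'. (\<forall>x\<in>{M..}. (f has_real_derivative f' x) (at x within {M..})) \<and> continuous_on {M..} f')"

end

theory Submission
  imports Defs
begin

text \<open>
  Write \<open>g = u' / sqrt (1 + u'\<^sup>2)\<close>, so that \<open>- g' = \<lambda> a f(u)\<close>. The weight is positive on
  \<open>(0,z)\<close> and \<open>r / sqrt (1 + r\<^sup>2)\<close> is increasing in \<open>r\<close>; hence \<open>g\<close> and \<open>u'\<close> decrease on
  \<open>[0,z]\<close>, and \<open>u'(0) = 0\<close> gives \<open>u' \<le> 0\<close> there. So \<open>u\<close> is decreasing and concave on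
  \<open>[0,z]\<close>. As \<open>u(z) \<ge> 0\<close>, concavity gives \<open>(\<eta>/z) u(0) \<le> u(x) \<le> u(0)\<close> on
  \<open>[0, z - \<eta>]\<close>, and it remains to bound \<open>u(0)\<close> from below by a multiple of \<open>\<lambda>\<^bsup>1/q\<^esup>\<close>.

  The special feature of the mean curvature operator is that \<open>|g| < 1\<close> however steep \<open>u\<close> is.
  Integrating the equation over an interval \<open>(x\<^sub>0, z - \<eta>)\<close> with \<open>x\<^sub>0 > 0\<close> therefore yields
  \<open>\<lambda> \<integral> a f(u) < 1\<close>, because \<open>g(x\<^sub>0) \<le> 0\<close>. Along the sequence \<open>u\<^sub>n(0) > c > 0\<close> for large
  \<open>n\<close>, so that all the values \<open>u\<^sub>n(x)\<close> with \<open>x \<le> z - \<eta>\<close> stay above \<open>(\<eta>/z) c\<close>; on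
  \<open>[(\<eta>/z) c, \<infinity>)\<close> positivity of \<open>f\<close> and its decay at infinity provide \<open>f(s) \<ge> k s\<^bsup>-q\<^esup>\<close> with \<open>k > 0\<close>
  (\<open>lower_bound_of_asymptotic_power\<close>). With \<open>A = \<integral> a > 0\<close> over that interval,
  \<open>\<lambda> k A u(0)\<^bsup>-q\<^esup> < 1\<close>, that is \<open>u(0) > (k A \<lambda>)\<^bsup>1/q\<^esup>\<close>. The part of the argument that
  concerns a single solution is \<open>regular_solution_estimate\<close>.

  Both the concavity and the integrated equation rest on the fundamental theorem of calculus for
  weak derivatives, \<open>integral_weak_deriv\<close>: a continuous function with weak derivative \<open>w\<close>
  satisfies \<open>v(y) - v(x) = \<integral> w\<close> over \<open>(x,y)\<close>. It follows by testing with \<open>C\<^sup>1\<close>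
  approximations of the indicator function of \<open>(x,y)\<close>.
\<close>

section \<open>A continuously differentiable step function\<close>

text \<open>
  The hat function is the linear B-spline with knots 0, 1, 2: a tent of mass one supported in
  \<open>[0,2]\<close>. In this form its antiderivative is a combination of squares of positive parts, whose
  derivatives can be computed without a case distinction at the knots.
\<close>

definition hat :: "real \<Rightarrow> real" where
  "hat s = max 0 s - 2 * max 0 (s - 1) + max 0 (s - 2)"

definition spline_step :: "real \<Rightarrow> real" where
  "spline_step s = (max 0 s)\<^sup>2 / 2 - (max 0 (s - 1))\<^sup>2 + (max 0 (s - 2))\<^sup>2 / 2"

lemma has_real_derivative_square_pos_part:
  fixes s :: real
  shows "((\<lambda>t. (max 0 t)\<^sup>2) has_real_derivative 2 * max 0 s) (at s)"
proof -
  consider "s < 0" | "s = 0" | "0 < s" by linarith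
  then show ?thesis
  proof cases
    case 1
    have "((\<lambda>t. 0) has_real_derivative 2 * max 0 s) (at s)" using 1 by auto
    then show ?thesis
      by (rule has_field_derivative_transform_within_open[where S="{..<0}"]) (use 1 in auto)
  next
    case 3
    have "((\<lambda>t. t\<^sup>2) has_real_derivative 2 * max 0 s) (at s)"
      using 3 by (auto intro!: derivative_eq_intros)
    then show ?thesis
      by (rule has_field_derivative_transform_within_open[where S="{0<..}"]) (use 3 in auto)
  next
    case 2
    have "((\<lambda>t. (max 0 t)\<^sup>2 / t) \<longlongrightarrow> 0) (at (0::real))"
    proof (rule Lim_null_comparison)
      show "eventually (\<lambda>t. norm ((max 0 t)\<^sup>2 / t) \<le> \<bar>t\<bar>) (at (0::real))"
        by (intro always_eventually) (auto simp: max_def power2_eq_square)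
      show "((\<lambda>t. \<bar>t\<bar>) \<longlongrightarrow> 0) (at (0::real))"
        by (rule tendsto_eq_intros | simp)+
    qed
    then show ?thesis using 2 by (simp add: has_field_derivative_iff)
  qed
qed

lemma has_real_derivative_spline_step [derivative_intros]:
  assumes "(g has_real_derivative g') (at s)"
  shows "((\<lambda>t. spline_step (g t)) has_real_derivative hat (g s) * g') (at s)"
proof -
  have "(spline_step has_real_derivative hat r) (at r)" for r
  proof -
    have *: "((\<lambda>t. (max 0 (t - c))\<^sup>2) has_real_derivative 2 * max 0 (r - c)) (at r)" for c
    proof -
      have "((\<lambda>t. t - c) has_real_derivative 1) (at r)"
        by (auto intro!: derivative_eq_intros)
      from DERIV_chain'[OF this has_real_derivative_square_pos_part] show ?thesis by simp
    qed
    have "((\<lambda>t. (max 0 t)\<^sup>2 / 2 - (max 0 (t - 1))\<^sup>2 + (max 0 (t - 2))\<^sup>2 / 2)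
        has_real_derivative 2 * max 0 r / 2 - 2 * max 0 (r - 1) + 2 * max 0 (r - 2) / 2) (at r)"
      using *[of 0] by (intro DERIV_add DERIV_diff DERIV_cdivide *) simp_all
    then show ?thesis
      by (simp add: spline_step_def[abs_def] hat_def)
  qed
  from DERIV_chain'[OF assms this] show ?thesis by (simp add: mult.commute)
qed

lemma continuous_on_hat [continuous_intros]:
  "continuous_on S g \<Longrightarrow> continuous_on S (\<lambda>t. hat (g t))"
  unfolding hat_def by (intro continuous_intros)

lemma continuous_on_spline_step [continuous_intros]:
  "continuous_on S g \<Longrightarrow> continuous_on S (\<lambda>t. spline_step (g t))"
  unfolding spline_step_def by (intro continuous_intros) auto

lemma hat_nonneg: "0 \<le> hat s"
  by (auto simp: hat_def max_def)

lemma hat_eq_0: "s \<le> 0 \<or> 2 \<le> s \<Longrightarrow> hat s = 0"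
  by (auto simp: hat_def max_def)

lemma spline_step_eq_0: "s \<le> 0 \<Longrightarrow> spline_step s = 0"
  by (auto simp: spline_step_def max_def)

lemma spline_step_eq_1: "2 \<le> s \<Longrightarrow> spline_step s = 1"
  by (simp add: spline_step_def max_def power2_eq_square field_simps)

lemma spline_step_mono: "s \<le> t \<Longrightarrow> spline_step s \<le> spline_step t"
  by (rule DERIV_nonneg_imp_nondecreasing)
    (auto intro!: derivative_eq_intros hat_nonneg exI[where x = "hat _"])

lemma spline_step_bounds: "0 \<le> spline_step s" "spline_step s \<le> 1"
  using spline_step_mono[of "min 0 s" s] spline_step_mono[of s "max 2 s"]
  by (auto simp: spline_step_eq_0 spline_step_eq_1)

lemma has_bochner_integral_hat: "has_bochner_integral lborel hat 1"
proof -
  have "has_bochner_integral lborel (\<lambda>s. hat s * indicator {0..2} s) (spline_step 2 - spline_step 0)"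
    by (rule has_bochner_integral_FTC_Icc_real)
      (auto intro!: derivative_eq_intros continuous_intros simp: continuous_on_eq_continuous_within[symmetric]
        intro: continuous_on_interior[of UNIV hat])
  moreover have "(\<lambda>s. hat s * indicator {0..2} s) = hat"
  proof
    show "hat s * indicator {0..2} s = hat s" for s
      by (cases "s \<in> {0..2}") (auto simp: hat_eq_0)
  qed
  ultimately show ?thesis
    by (simp add: spline_step_eq_0 spline_step_eq_1)
qed

text \<open>
  Rescaling concentrates the mass of the hat at \<open>x\<close>, from the left or from the right according
  to the shift \<open>c\<close>. The substitution \<open>s = m (t - x) + c\<close> turns the integral into one of
  \<open>g (x + (s - c) / m)\<close> against a fixed density, to which dominated convergence applies.
\<close>

lemma hat_approximate_identity:
  fixes g :: "real \<Rightarrow> real"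
  assumes cont: "continuous_on UNIV g" and bdd: "\<And>t. \<bar>g t\<bar> \<le> K"
  defines "m \<equiv> \<lambda>n. real (Suc n)"
  shows "integrable lborel (\<lambda>t. g t * (hat (m n * (t - x) + c) * m n))"
    and "(\<lambda>n. LINT t|lborel. g t * (hat (m n * (t - x) + c) * m n)) \<longlonglongrightarrow> g x"
proof -
  have m: "m n > 0" for n by (simp add: m_def)
  have gm [measurable]: "g \<in> borel_measurable borel"
    using cont by (rule borel_measurable_continuous_onI)
  have hm [measurable]: "hat \<in> borel_measurable borel"
    by (intro borel_measurable_continuous_onI continuous_intros)
  have hi: "integrable lborel hat"
    using has_bochner_integral_hat by (rule integrable.intros)
  have scaled: "(\<lambda>s. g (x - c / m n + 1 / m n * s) *
        (hat (m n * (x - c / m n + 1 / m n * s - x) + c) * m n)) =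
      (\<lambda>s. m n * (g (x + (s - c) / m n) * hat s))" for n
    using m[of n] by (intro ext) (simp add: field_simps)
  have int: "integrable lborel (\<lambda>s. g (x + (s - c) / m n) * hat s)" for n
  proof (rule Bochner_Integration.integrable_bound)
    show "integrable lborel (\<lambda>s. K * hat s)" using hi by simp
    show "AE s in lborel. norm (g (x + (s - c) / m n) * hat s) \<le> norm (K * hat s)"
      using bdd hat_nonneg by (intro AE_I2) (auto simp: abs_mult intro!: mult_right_mono order_trans[OF bdd])
  qed simp
  show "integrable lborel (\<lambda>t. g t * (hat (m n * (t - x) + c) * m n))"
  proof (rule iffD1[OF lborel_integrable_real_affine_iff[of "1 / m n"]])
    show "1 / m n \<noteq> 0" using m[of n] by simp
    show "integrable lborel (\<lambda>s. g (x - c / m n + 1 / m n * s) *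
        (hat (m n * (x - c / m n + 1 / m n * s - x) + c) * m n))"
      unfolding scaled using int by simp
  qed
  have eq: "(LINT t|lborel. g t * (hat (m n * (t - x) + c) * m n)) =
      (LINT s|lborel. g (x + (s - c) / m n) * hat s)" for n
    by (subst lborel_integral_real_affine[of "1 / m n" _ "x - c / m n"], use m[of n] in simp)
      (unfold scaled, use m[of n] in simp)
  have "(\<lambda>n. LINT s|lborel. g (x + (s - c) / m n) * hat s) \<longlonglongrightarrow> (LINT s|lborel. g x * hat s)"
  proof (rule integral_dominated_convergence)
    show "integrable lborel (\<lambda>s. K * hat s)" using hi by simp
    show "AE s in lborel. norm (g (x + (s - c) / m n) * hat s) \<le> K * hat s" for n
      using bdd hat_nonneg by (intro AE_I2) (auto simp: abs_mult intro!: mult_right_mono)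
    show "AE s in lborel. (\<lambda>n. g (x + (s - c) / m n) * hat s) \<longlonglongrightarrow> g x * hat s"
    proof (intro AE_I2 tendsto_mult tendsto_const)
      fix s
      have "(\<lambda>n. (s - c) / m n) \<longlonglongrightarrow> 0"
        using tendsto_mult_right_zero[OF LIMSEQ_inverse_real_of_nat, of "s - c"]
        by (simp add: m_def divide_inverse)
      then have "(\<lambda>n. x + (s - c) / m n) \<longlonglongrightarrow> x"
        using tendsto_add[OF tendsto_const, of _ 0 sequentially x] by simp
      then show "(\<lambda>n. g (x + (s - c) / m n)) \<longlonglongrightarrow> g x"
        by (rule continuous_on_tendsto_compose[OF cont]) auto
    qed
  qed simp_all
  moreover have "(LINT s|lborel. g x * hat s) = g x"
    by (simp add: has_bochner_integral_integral_eq[OF has_bochner_integral_hat])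
  ultimately show "(\<lambda>n. LINT t|lborel. g t * (hat (m n * (t - x) + c) * m n)) \<longlonglongrightarrow> g x"
    by (simp only: eq)
qed

section \<open>Weak derivatives of continuous functions\<close>

text \<open>
  Test with \<open>\<phi>\<^sub>n\<close>, which rises from 0 to 1 just to the right of \<open>x\<close> and falls back to 0 just to
  the left of \<open>y\<close>. On one side \<open>\<phi>\<^sub>n\<close> tends to the indicator function of \<open>(x,y)\<close>; on the
  other its derivative is the difference of two approximate identities, at \<open>x\<close> and at \<open>y\<close>.
  Since the support of \<open>\<phi>\<^sub>n\<close> stays strictly between \<open>x\<close> and \<open>y\<close>, the end points of the
  interval are admissible values of \<open>x\<close> and \<open>y\<close>.
\<close>

lemma integral_weak_deriv:
  fixes v w :: "real \<Rightarrow> real"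
  assumes wd: "has_weak_deriv {a<..<b} v w" and cont: "continuous_on {a..b} v"
    and xy: "a \<le> x" "x < y" "y \<le> b"
  shows "(LINT t:{x<..<y}|lebesgue. w t) = v y - v x"
proof -
  define m where "m n = real (Suc n)" for n
  \<comment> \<open>With these shifts the steps take place on \<open>[x + 1/m, x + 3/m]\<close> and \<open>[y - 3/m, y - 1/m]\<close>;
      they do not overlap as soon as \<open>m (y - x) \<ge> 4\<close>.\<close>
  define \<phi> where "\<phi> n t = spline_step (m n * (t - x) + (- 1)) - spline_step (m n * (t - y) + 3)" for n t
  define D where "D n t = hat (m n * (t - x) + (- 1)) * m n - hat (m n * (t - y) + 3) * m n" for n t
  \<comment> \<open>The values of \<open>v\<close> outside \<open>[a,b]\<close> are arbitrary; its constant extension is bounded and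
      continuous on the whole line.\<close>
  define v0 where "v0 t = v (max a (min b t))" for t
  have m: "m n > 0" for n by (simp add: m_def)
  have D: "(\<phi> n has_real_derivative D n t) (at t)" for n t
    unfolding \<phi>_def D_def by (auto intro!: derivative_eq_intros)
  have deriv: "deriv (\<phi> n) = D n" for n
    using D DERIV_imp_deriv by blast
  have m_top: "filterlim m at_top sequentially"
    unfolding m_def by (rule filterlim_compose[OF filterlim_real_sequentially filterlim_Suc])
  have ev: "\<forall>\<^sub>F n in sequentially. 4 \<le> m n * (y - x)"
    using filterlim_tendsto_pos_mult_at_top[OF tendsto_const, of "y - x" m sequentially] m_top xy
    by (simp add: filterlim_at_top mult.commute)
  have outside: "\<phi> n t = 0 \<and> D n t = 0"
    if n: "4 \<le> m n * (y - x)" and t: "t < x + 1 / m n \<or> y - 1 / m n < t" for n t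
  proof -
    from t have "m n * (t - x) < 1 \<or> m n * (t - y) > - 1"
      using m[of n] by (auto simp: field_simps)
    moreover have "m n * (t - x) = m n * (t - y) + m n * (y - x)"
      by (simp add: algebra_simps)
    ultimately show ?thesis
      using n by (auto simp: \<phi>_def D_def hat_eq_0 spline_step_eq_0 spline_step_eq_1)
  qed
  have test: "test_fun {a<..<b} (\<phi> n)" if n: "4 \<le> m n * (y - x)" for n
  proof -
    have "closure {t. \<phi> n t \<noteq> 0} \<subseteq> {x + 1 / m n .. y - 1 / m n}"
      using outside[OF n] by (intro closure_minimal) (auto simp: not_less[symmetric])
    moreover from this have "compact (closure {t. \<phi> n t \<noteq> 0})"
      by (meson bounded_closed_interval bounded_subset closed_closure compact_eq_bounded_closed)
    moreover have "{x + 1 / m n .. y - 1 / m n} \<subseteq> {a<..<b}"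
    proof
      fix t
      assume "t \<in> {x + 1 / m n .. y - 1 / m n}"
      moreover have "1 / m n > 0" using m[of n] by simp
      ultimately show "t \<in> {a<..<b}"
        using xy unfolding atLeastAtMost_iff greaterThanLessThan_iff by linarith
    qed
    moreover have "\<phi> n C1_differentiable_on UNIV"
      unfolding C1_differentiable_on_def
    proof (intro exI[of _ "D n"] conjI ballI)
      show "(\<phi> n has_vector_derivative D n t) (at t)" for t
        using D by (simp add: has_real_derivative_iff_has_vector_derivative)
      show "continuous_on UNIV (D n)"
        unfolding D_def by (intro continuous_intros)
    qed
    ultimately show ?thesis
      unfolding test_fun_def by blast
  qed
  have v0_cont: "continuous_on UNIV v0"
    unfolding v0_def using xy
    by (intro continuous_on_compose2[OF cont] continuous_intros) auto
  have "compact (v ` {a..b})"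
    using cont by (intro compact_continuous_image) auto
  then obtain K where "\<And>r. r \<in> v ` {a..b} \<Longrightarrow> norm r \<le> K"
    using compact_imp_bounded bounded_iff by metis
  then have v0_bdd: "\<bar>v0 t\<bar> \<le> K" for t
    unfolding v0_def using xy by simp
  note approx = hat_approximate_identity[OF v0_cont v0_bdd, folded m_def]
  have "(\<lambda>n. LINT t|lborel. v0 t * D n t) \<longlonglongrightarrow> v0 x - v0 y"
  proof -
    have "(LINT t|lborel. v0 t * D n t) = (LINT t|lborel. v0 t * (hat (m n * (t - x) + (- 1)) * m n))
        - (LINT t|lborel. v0 t * (hat (m n * (t - y) + 3) * m n))" for n
      unfolding D_def right_diff_distrib[of "v0 _"]
      by (rule Bochner_Integration.integral_diff[OF approx(1) approx(1)])
    then show ?thesis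
      using tendsto_diff[OF approx(2)[of x "- 1"] approx(2)[of y 3]] by simp
  qed
  moreover have "(LINT t|lborel. v0 t * D n t) = - (LINT t|lebesgue_on {a<..<b}. w t * \<phi> n t)"
    if n: "4 \<le> m n * (y - x)" for n
  proof -
    have "(LINT t|lebesgue_on {a<..<b}. v t * D n t) =
        (LINT t|lebesgue. indicator {a<..<b} t *\<^sub>R (v t * D n t))"
      by (simp add: integral_restrict_space)
    also have "(\<lambda>t. indicator {a<..<b} t *\<^sub>R (v t * D n t)) = (\<lambda>t. v0 t * D n t)"
    proof
      fix t
      have "1 / m n > 0" using m[of n] by simp
      then have "t \<le> a \<or> b \<le> t \<Longrightarrow> D n t = 0"
        using outside[OF n, of t] xy by linarith
      then show "indicator {a<..<b} t *\<^sub>R (v t * D n t) = v0 t * D n t"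
        by (cases "t \<le> a \<or> b \<le> t") (auto simp: v0_def max_def min_def)
    qed
    also have "(LINT t|lebesgue. v0 t * D n t) = (LINT t|lborel. v0 t * D n t)"
      by (intro integral_completion borel_measurable_continuous_onI continuous_intros v0_cont
          | simp add: D_def[abs_def])+
    finally show ?thesis
      using wd test[OF n] unfolding has_weak_deriv_def deriv[symmetric] by simp
  qed
  then have "\<forall>\<^sub>F n in sequentially.
      (LINT t|lborel. v0 t * D n t) = - (LINT t|lebesgue_on {a<..<b}. w t * \<phi> n t)"
    by (rule eventually_mono[OF ev])
  ultimately have "(\<lambda>n. - (LINT t|lebesgue_on {a<..<b}. w t * \<phi> n t)) \<longlonglongrightarrow> v0 x - v0 y"
    by (rule Lim_transform_eventually)
  from tendsto_minus[OF this]
  have "(\<lambda>n. LINT t|lebesgue_on {a<..<b}. w t * \<phi> n t) \<longlonglongrightarrow> v y - v x"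
    using xy by (simp add: v0_def)
  moreover have "(\<lambda>n. LINT t|lebesgue_on {a<..<b}. w t * \<phi> n t)
      \<longlonglongrightarrow> (LINT t|lebesgue_on {a<..<b}. w t * indicator {x<..<y} t)"
  proof (rule integral_dominated_convergence)
    have wi: "integrable (lebesgue_on {a<..<b}) w"
      using wd by (simp add: has_weak_deriv_def)
    then show "integrable (lebesgue_on {a<..<b}) (\<lambda>t. \<bar>w t\<bar>)" by simp
    have [measurable]: "w \<in> borel_measurable (lebesgue_on {a<..<b})"
      using wi by simp
    show "(\<lambda>t. w t * indicator {x<..<y} t) \<in> borel_measurable (lebesgue_on {a<..<b})"
      using xy by (intro borel_measurable_times borel_measurable_indicator)
        (auto simp: sets_restrict_space_iff)
    have [measurable]: "\<phi> n \<in> borel_measurable (lebesgue_on {a<..<b})" for n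
      unfolding \<phi>_def
      by (intro continuous_imp_measurable_on_sets_lebesgue continuous_intros) auto
    show "(\<lambda>t. w t * \<phi> n t) \<in> borel_measurable (lebesgue_on {a<..<b})" for n
      by measurable
    show "AE t in lebesgue_on {a<..<b}. norm (w t * \<phi> n t) \<le> \<bar>w t\<bar>" for n
    proof (intro AE_I2)
      fix t
      have "\<bar>\<phi> n t\<bar> \<le> 1"
        using spline_step_bounds[of "m n * (t - x) + (- 1)"] spline_step_bounds[of "m n * (t - y) + 3"]
        unfolding \<phi>_def by linarith
      then show "norm (w t * \<phi> n t) \<le> \<bar>w t\<bar>"
        by (simp add: abs_mult mult_left_le)
    qed
    show "AE t in lebesgue_on {a<..<b}. (\<lambda>n. w t * \<phi> n t) \<longlonglongrightarrow> w t * indicator {x<..<y} t"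
    proof (intro AE_I2 tendsto_mult tendsto_const tendsto_eventually)
      fix t
      show "\<forall>\<^sub>F n in sequentially. \<phi> n t = indicator {x<..<y} t"
      proof (cases "t \<in> {x<..<y}")
        case True
        have "\<forall>\<^sub>F n in sequentially. 3 \<le> m n * (t - x) \<and> 3 \<le> m n * (y - t)"
          using True filterlim_tendsto_pos_mult_at_top[OF tendsto_const, of "t - x" m sequentially]
            filterlim_tendsto_pos_mult_at_top[OF tendsto_const, of "y - t" m sequentially] m_top
          by (simp add: filterlim_at_top mult.commute eventually_conj)
        then show ?thesis
        proof eventually_elim
          case (elim n)
          then have "m n * (t - y) + 3 \<le> 0" by (simp add: algebra_simps)
          with elim True show ?case by (simp add: \<phi>_def spline_step_eq_0 spline_step_eq_1)
        qed
      next
        case False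
        show ?thesis
          using ev
        proof eventually_elim
          case (elim n)
          have "1 / m n > 0" using m[of n] by simp
          then have "t < x + 1 / m n \<or> y - 1 / m n < t"
            using False unfolding greaterThanLessThan_iff by linarith
          with outside[OF elim] False show ?case by auto
        qed
      qed
    qed
  qed
  ultimately have "v y - v x = (LINT t|lebesgue_on {a<..<b}. w t * indicator {x<..<y} t)"
    by (rule LIMSEQ_unique)
  also have "\<dots> = (LINT t:{x<..<y}|lebesgue. w t)"
    unfolding set_lebesgue_integral_def using xy
    by (subst integral_restrict_space) (auto intro!: Bochner_Integration.integral_cong simp: indicator_def)
  finally show ?thesis by simp
qed

lemma set_integrable_weak_deriv:
  assumes "has_weak_deriv {a<..<b} v w" "a \<le> x" "y \<le> b"
  shows "set_integrable lebesgue {x<..<y} w"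
proof -
  have "set_integrable lebesgue {a<..<b} w"
    using assms by (simp add: has_weak_deriv_def set_integrable_def integrable_restrict_space)
  then show ?thesis
    by (rule set_integrable_subset) (use assms in auto)
qed

lemma antimono_on_of_weak_deriv_nonpos:
  assumes wd: "has_weak_deriv {a<..<b} v w" and cont: "continuous_on {a..b} v"
    and sub: "a \<le> c" "d \<le> b" and neg: "AE t in lebesgue_on {c<..<d}. w t \<le> 0"
    and xy: "c \<le> x" "x \<le> y" "y \<le> d"
  shows "v y \<le> v x"
proof (cases "x = y")
  case False
  have "AE t in lebesgue. t \<in> {c<..<d} \<longrightarrow> w t \<le> 0"
    using neg by (simp add: AE_restrict_space_iff)
  then have "AE t in lebesgue. 0 \<le> - (indicator {x<..<y} t *\<^sub>R w t)"
    by eventually_elim (use xy in \<open>auto simp: indicator_def\<close>)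
  then have "0 \<le> (LINT t|lebesgue. - (indicator {x<..<y} t *\<^sub>R w t))"
    by (rule integral_nonneg_AE)
  then have "(LINT t:{x<..<y}|lebesgue. w t) \<le> 0"
    by (simp add: set_lebesgue_integral_def)
  then show ?thesis
    using integral_weak_deriv[OF wd cont, of x y] False sub xy by simp
qed simp

text \<open>
  Concavity, from the comparison of the two difference quotients of \<open>u\<close> on either side of \<open>x\<close>
  with \<open>u' x\<close>.
\<close>

lemma concave_of_weak_deriv_antimono:
  assumes wd: "has_weak_deriv {a<..<b} u u'" and cont: "continuous_on {a..b} u"
    and sub: "a \<le> c" "d \<le> b"
    and anti: "\<And>x y. c \<le> x \<Longrightarrow> x \<le> y \<Longrightarrow> y \<le> d \<Longrightarrow> u' y \<le> u' x"
    and x: "c \<le> x" "x \<le> d"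
  shows "(d - x) * u c + (x - c) * u d \<le> (d - c) * u x"
proof -
  have seg: "(s - r) * u' s \<le> u s - u r \<and> u s - u r \<le> (s - r) * u' r"
    if rs: "c \<le> r" "r \<le> s" "s \<le> d" for r s
  proof (cases "r = s")
    case False
    have int: "set_integrable lebesgue {r<..<s} u'"
      using set_integrable_weak_deriv[OF wd] rs sub by simp
    have const: "set_integrable lebesgue {r<..<s} (\<lambda>_. k)"
      "(LINT t:{r<..<s}|lebesgue. k) = (s - r) * k" for k :: real
      using rs by (auto simp: set_integrable_def set_lebesgue_integral_def)
    have "(LINT t:{r<..<s}|lebesgue. u' s) \<le> (LINT t:{r<..<s}|lebesgue. u' t)"
      "(LINT t:{r<..<s}|lebesgue. u' t) \<le> (LINT t:{r<..<s}|lebesgue. u' r)"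
      using rs by (intro set_integral_mono int const anti; simp)+
    then show ?thesis
      using integral_weak_deriv[OF wd cont, of r s] False rs sub by (simp add: const)
  qed simp
  have "(x - c) * (u d - u x) \<le> (x - c) * ((d - x) * u' x)"
    using seg[of x d] x by (intro mult_left_mono) auto
  also have "\<dots> = (d - x) * ((x - c) * u' x)" by simp
  also have "\<dots> \<le> (d - x) * (u x - u c)"
    using seg[of c x] x by (intro mult_left_mono) auto
  finally show ?thesis by (simp add: algebra_simps)
qed

section \<open>The mean curvature operator\<close>

text \<open>The flux \<open>r / sqrt (1 + r\<^sup>2)\<close> is the sine of the angle of inclination \<open>arctan r\<close>.\<close>

lemma div_sqrt_le_iff:
  fixes r s :: real
  shows "r / sqrt (1 + r\<^sup>2) \<le> s / sqrt (1 + s\<^sup>2) \<longleftrightarrow> r \<le> s"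
proof -
  have "x / sqrt (1 + x\<^sup>2) = sin (arctan x)" for x :: real
    by (simp add: sin_arctan)
  then show ?thesis
    using sin_mono_le_eq[of "arctan r" "arctan s"] arctan_bounded[of r] arctan_bounded[of s]
    by (simp add: arctan_le_iff)
qed

lemma abs_div_sqrt_less_1: "\<bar>r / sqrt (1 + r\<^sup>2)\<bar> < 1" for r :: real
proof -
  have "\<bar>r\<bar> < sqrt (1 + r\<^sup>2)"
    by (metis less_add_same_cancel2 real_sqrt_abs real_sqrt_less_iff zero_less_one)
  then show ?thesis by (simp add: abs_divide divide_less_eq add_nonneg_nonneg not_less)
qed

section \<open>Properties of the nonlinearity and the weight\<close>

text \<open>
  The quotient \<open>f s / s powr r\<close> exceeds \<open>h / 2\<close> near infinity and attains a positive minimum on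
  the compact rest of the ray.
\<close>

lemma lower_bound_of_asymptotic_power:
  fixes f :: "real \<Rightarrow> real"
  assumes cont: "continuous_on {c..} f" and pos: "\<And>s. c \<le> s \<Longrightarrow> 0 < f s" and c: "0 < c"
    and lim: "((\<lambda>s. f s / s powr r) \<longlongrightarrow> h) at_top" and h: "0 < h"
  obtains k where "0 < k" and "\<And>s. c \<le> s \<Longrightarrow> k * s powr r \<le> f s"
proof -
  have "\<forall>\<^sub>F s in at_top. h / 2 < f s / s powr r"
    using order_tendstoD(1)[OF lim, of "h / 2"] h by linarith
  then obtain N where N: "\<And>s. N \<le> s \<Longrightarrow> h / 2 < f s / s powr r"
    by (auto simp: eventually_at_top_linorder)
  have "continuous_on {c..max c N} (\<lambda>s. f s / s powr r)"
    using c by (intro continuous_intros continuous_on_subset[OF cont]) auto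
  then obtain s0 where s0: "s0 \<in> {c..max c N}"
    and min: "\<And>s. s \<in> {c..max c N} \<Longrightarrow> f s0 / s0 powr r \<le> f s / s powr r"
    using continuous_attains_inf[of "{c..max c N}" "\<lambda>s. f s / s powr r"] by auto
  show ?thesis
  proof
    show "0 < min (h / 2) (f s0 / s0 powr r)"
      using h s0 c pos by simp
    fix s assume s: "c \<le> s"
    have "min (h / 2) (f s0 / s0 powr r) \<le> f s / s powr r"
      using less_imp_le[OF N[of s]] min[of s] s by (cases "N \<le> s") (auto simp: min_le_iff_disj)
    then show "min (h / 2) (f s0 / s0 powr r) * s powr r \<le> f s"
      using s c by (simp add: le_divide_eq)
  qed
qed

lemma set_integrable_Linfty_on:
  assumes "Linfty_on {a<..<b} g" and "a \<le> x" "y \<le> b"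
  shows "set_integrable lebesgue {x<..<y} g"
proof -
  obtain K where gm: "g \<in> borel_measurable (lebesgue_on {a<..<b})"
    and K: "AE t in lebesgue_on {a<..<b}. \<bar>g t\<bar> \<le> K"
    using assms by (auto simp: Linfty_on_def)
  have "integrable (lebesgue_on {a<..<b}) (\<lambda>_. K)"
    by (cases "a \<le> b") (auto simp: integrable_restrict_space)
  then have "integrable (lebesgue_on {a<..<b}) g"
    by (rule Bochner_Integration.integrable_bound) (use gm K in auto)
  then have "set_integrable lebesgue {a<..<b} g"
    by (simp add: set_integrable_def integrable_restrict_space)
  then show ?thesis
    by (rule set_integrable_subset) (use assms in auto)
qed

lemma set_integral_pos:
  fixes a :: "real \<Rightarrow> real"
  assumes int: "set_integrable lebesgue {x0<..<x1} a" and less: "x0 < x1"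
    and pos: "AE x in lebesgue. x \<in> {x0<..<x1} \<longrightarrow> 0 < a x"
  shows "0 < (LINT x:{x0<..<x1}|lebesgue. a x)"
proof -
  let ?b = "\<lambda>x. indicator {x0<..<x1} x *\<^sub>R a x"
  have nn: "AE x in lebesgue. 0 \<le> ?b x"
    using pos by eventually_elim (auto simp: indicator_def)
  have "(LINT x|lebesgue. ?b x) \<noteq> 0"
  proof
    assume "(LINT x|lebesgue. ?b x) = 0"
    then have "AE x in lebesgue. ?b x = 0"
      using integral_nonneg_eq_0_iff_AE[OF int[unfolded set_integrable_def] nn] by simp
    with pos have "AE x in lebesgue. x \<notin> {x0<..<x1}"
      by eventually_elim (auto simp: indicator_def)
    then have "emeasure lebesgue {x0<..<x1} = 0"
      by (subst (asm) AE_iff_measurable[of "{x0<..<x1}"]) auto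
    then show False using less by simp
  qed
  moreover have "0 \<le> (LINT x|lebesgue. ?b x)" using nn by (rule integral_nonneg_AE)
  ultimately show ?thesis unfolding set_lebesgue_integral_def by linarith
qed

section \<open>Lower bounds for positive solutions\<close>

text \<open>
  The two consequences of the sign of the weight for one solution: concavity of \<open>u\<close> on \<open>[0,z]\<close>,
  used as a lower bound by the chord that ends at height 0 in \<open>z\<close>, and the bound on the mass of
  the right-hand side by the largest possible flux. In the latter, \<open>k\<close> is a lower bound of \<open>f\<close> on
  an interval that contains the range of \<open>u\<close> over \<open>[0,x1]\<close>.
\<close>

lemma regular_solution_estimate:
  fixes a f u :: "real \<Rightarrow> real"
  assumes sol: "regular_solution a f l u" and nonneg: "\<And>x. x \<in> {0..1} \<Longrightarrow> 0 \<le> u x"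
    and l: "0 \<le> l" and z: "z < 1" and a: "AE x in lebesgue_on {0<..<z}. 0 < a x"
    and f: "\<And>s. 0 \<le> s \<Longrightarrow> 0 \<le> f s"
    and x1: "0 < x0" "x0 < x1" "x1 < z"
    and ai: "set_integrable lebesgue {x0<..<x1} a"
    and low: "\<And>s. (1 - x1 / z) * u 0 \<le> s \<Longrightarrow> s \<le> u 0 \<Longrightarrow> k \<le> f s"
  shows "\<And>x. x \<in> {0..x1} \<Longrightarrow> (1 - x1 / z) * u 0 \<le> u x"
    and "l * k * (LINT t:{x0<..<x1}|lebesgue. a t) < 1"
proof -
  obtain u' w where u': "has_weak_deriv {0<..<1} u u'" and cont': "continuous_on {0..1} u'"
    and w: "has_weak_deriv {0<..<1} (\<lambda>x. u' x / sqrt (1 + (u' x)\<^sup>2)) w"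
    and eq: "AE x in lebesgue_on {0<..<1}. - w x = l * a x * f (u x)"
    and bc: "u' 0 = 0" and cont: "continuous_on {0..1} u"
    using sol unfolding regular_solution_def by blast
  define g where "g x = u' x / sqrt (1 + (u' x)\<^sup>2)" for x
  note w = w[folded g_def]
  have cont_g: "continuous_on {0..1} g"
    unfolding g_def
    by (intro continuous_intros cont') (simp add: add_nonneg_eq_0_iff)
  have ae: "AE t in lebesgue. t \<in> {0<..<z} \<longrightarrow> 0 < a t \<and> w t = - (l * a t * f (u t))"
  proof -
    have "AE t in lebesgue. t \<in> {0<..<1} \<longrightarrow> - w t = l * a t * f (u t)"
      using eq by (simp add: AE_restrict_space_iff)
    moreover have "AE t in lebesgue. t \<in> {0<..<z} \<longrightarrow> 0 < a t"
      using a by (simp add: AE_restrict_space_iff)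
    ultimately show ?thesis
      by eventually_elim (use z in auto)
  qed
  have "AE t in lebesgue. t \<in> {0<..<z} \<longrightarrow> w t \<le> 0"
    using ae by eventually_elim (use l f nonneg z in \<open>auto intro!: mult_nonneg_nonneg\<close>)
  then have "AE t in lebesgue_on {0<..<z}. w t \<le> 0"
    by (simp add: AE_restrict_space_iff)
  note g_anti = antimono_on_of_weak_deriv_nonpos[OF w cont_g _ _ this]
  have anti: "u' y \<le> u' x" if "0 \<le> x" "x \<le> y" "y \<le> z" for x y
    using g_anti[of x y] that z by (simp add: g_def div_sqrt_le_iff)
  have conc: "(1 - x / z) * u 0 \<le> u x" if "0 \<le> x" "x \<le> z" for x
  proof -
    have "(z - x) * u 0 + x * u z \<le> z * u x"
      using concave_of_weak_deriv_antimono[OF u' cont, of 0 z x] anti that x1 z by simp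
    moreover have "0 \<le> x * u z" using that z nonneg[of z] by simp
    ultimately have "(z - x) * u 0 \<le> z * u x" by linarith
    then show ?thesis using x1 by (simp add: field_simps)
  qed
  have u_low: "(1 - x1 / z) * u 0 \<le> u x" if "x \<in> {0..x1}" for x
  proof -
    have "(1 - x1 / z) * u 0 \<le> (1 - x / z) * u 0"
      using that x1 nonneg[of 0] by (intro mult_right_mono) (auto simp: divide_right_mono)
    also have "\<dots> \<le> u x" using conc[of x] that x1 by simp
    finally show ?thesis .
  qed
  then show "\<And>x. x \<in> {0..x1} \<Longrightarrow> (1 - x1 / z) * u 0 \<le> u x" .
  have u'_neg: "u' t \<le> 0" if "0 \<le> t" "t \<le> z" for t
    using anti[of 0 t] that bc by simp
  have u_up: "u x \<le> u 0" if "0 \<le> x" "x \<le> z" for x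
  proof -
    have "AE t in lebesgue_on {0<..<z}. u' t \<le> 0"
      using u'_neg by (intro AE_I2) simp
    then show ?thesis
      using antimono_on_of_weak_deriv_nonpos[OF u' cont, of 0 z 0 x] that z by simp
  qed
  have "AE t in lebesgue. t \<in> {x0<..<x1} \<longrightarrow> l * k * a t \<le> - w t"
    using ae
  proof eventually_elim
    case (elim t)
    show ?case
    proof
      assume t: "t \<in> {x0<..<x1}"
      then have at: "0 < a t" "w t = - (l * a t * f (u t))" using elim x1 by auto
      have "k \<le> f (u t)" using low[of "u t"] u_low[of t] u_up[of t] t x1 by auto
      then have "l * a t * k \<le> l * a t * f (u t)"
        using at l by (intro mult_left_mono) auto
      then show "l * k * a t \<le> - w t" using at by (simp add: ac_simps)
    qed
  qed
  then have "(LINT t:{x0<..<x1}|lebesgue. l * k * a t) \<le> (LINT t:{x0<..<x1}|lebesgue. - w t)"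
  proof (intro set_integral_mono_AE)
    show "set_integrable lebesgue {x0<..<x1} (\<lambda>t. l * k * a t)"
      using ai by simp
    show "set_integrable lebesgue {x0<..<x1} (\<lambda>t. - w t)"
      using set_integrable_weak_deriv[OF w, of x0 x1] x1 z by (simp add: set_integrable_def)
  qed
  also have "\<dots> = g x0 - g x1"
    using integral_weak_deriv[OF w cont_g, of x0 x1] x1 z
    by (simp add: set_lebesgue_integral_def)
  also have "\<dots> < 1"
  proof -
    have "g x0 \<le> 0"
      using u'_neg[of x0] x1 by (simp add: g_def divide_nonpos_nonneg)
    moreover have "\<bar>g x1\<bar> < 1" unfolding g_def by (rule abs_div_sqrt_less_1)
    ultimately show ?thesis by linarith
  qed
  finally show "l * k * (LINT t:{x0<..<x1}|lebesgue. a t) < 1" by simp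
qed

theorem theorem6p1:
  fixes a f :: "real \<Rightarrow> real" and z h p q M :: real
    and lam :: "nat \<Rightarrow> real" and u :: "nat \<Rightarrow> real \<Rightarrow> real"
  assumes "Linfty_on {0<..<1} a"
    and "(LINT x|lebesgue_on {0<..<1}. a x) < 0"
    and "0 < z" "z < 1"
    and "AE x in lebesgue_on {0<..<z}. 0 < a x"
    and "AE x in lebesgue_on {z<..<1}. a x < 0"
    and "continuous_on UNIV f"
    and "f 0 = 0"
    and "\<And>s. 0 < s \<Longrightarrow> 0 < f s"
    and "0 < h" "0 < p" "0 < q" "q < 1"
    and "((\<lambda>s. f s / s powr p) \<longlongrightarrow> 1) (at_right 0)"
    and "((\<lambda>s. f s / s powr (- q)) \<longlongrightarrow> h) at_top"
    and "0 < M"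
    and "\<And>s. 0 \<le> s \<Longrightarrow> f s \<le> f M"
    and "\<And>m. 0 \<le> m \<Longrightarrow> f m = f M \<Longrightarrow> m \<le> M"
    and "C1_on_ray M f"
    and "strict_mono_on {0<..<M} f"
    and "strict_antimono_on {M<..} f"
    and "\<And>n. 1 \<le> n \<Longrightarrow> regular_solution a f (lam n) (u n)"
    and "\<And>n. 1 \<le> n \<Longrightarrow> positive_on_unit (u n)"
    and "filterlim lam at_top sequentially"
    and "0 < liminf (\<lambda>n. ereal (u n 0))"
  shows "\<forall>\<eta>\<in>{0<..<z}. \<exists>C>0. \<exists>n0\<ge>1. \<forall>n\<ge>n0. \<forall>x\<in>{0..z - \<eta>}.
           C * lam n powr (1 / q) \<le> u n x"
proof
  fix \<eta> assume \<eta>: "\<eta> \<in> {0<..<z}"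
  \<comment> \<open>Any \<open>x0\<close> in \<open>(0, z - \<eta>)\<close> would serve.\<close>
  define x0 x1 where "x0 = (z - \<eta>) / 2" and "x1 = z - \<eta>"
  define A where "A = (LINT t:{x0<..<x1}|lebesgue. a t)"
  have x: "0 < x0" "x0 < x1" "x1 < z" using \<eta> by (auto simp: x0_def x1_def)
  have ratio: "1 - x1 / z = \<eta> / z" using \<open>0 < z\<close> by (simp add: x1_def field_simps)
  have \<eta>z: "0 < \<eta> / z" using \<eta> by simp
  have ai: "set_integrable lebesgue {x0<..<x1} a"
    using set_integrable_Linfty_on[OF assms(1)] x \<open>z < 1\<close> by simp
  have "AE t in lebesgue. t \<in> {0<..<z} \<longrightarrow> 0 < a t"
    using assms(5) by (simp add: AE_restrict_space_iff)
  then have A: "0 < A"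
    unfolding A_def using x by (intro set_integral_pos ai) (auto elim!: eventually_mono)
  obtain c where c: "0 < c" "ereal c < liminf (\<lambda>n. ereal (u n 0))"
    using ereal_dense2[OF assms(25)] by auto
  have "0 < \<eta> / z * c" using \<eta>z c(1) by (rule mult_pos_pos)
  moreover from this have "0 < f s" if "\<eta> / z * c \<le> s" for s
    using assms(9)[of s] that by linarith
  ultimately obtain k where k: "0 < k" "\<And>s. \<eta> / z * c \<le> s \<Longrightarrow> k * s powr (- q) \<le> f s"
    using lower_bound_of_asymptotic_power[OF continuous_on_subset[OF assms(7) subset_UNIV] _ _
        assms(15,10)] by blast
  have "\<forall>\<^sub>F n in sequentially. c < u n 0 \<and> 0 < lam n \<and> 1 \<le> n"
    using less_LiminfD[OF c(2)] filterlim_at_top_dense[THEN iffD1, OF assms(24)] eventually_ge_at_top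
    by (intro eventually_conj) simp_all
  then obtain n0 where n0: "\<And>n. n0 \<le> n \<Longrightarrow> c < u n 0 \<and> 0 < lam n \<and> 1 \<le> n"
    by (auto simp: eventually_sequentially)
  let ?C = "\<eta> / z * (k * A) powr (1 / q)"
  have "?C * lam n powr (1 / q) \<le> u n x" if n: "n0 \<le> n" and xr: "x \<in> {0..z - \<eta>}" for n x
  proof -
    have u0: "c < u n 0" and lam: "0 < lam n" and "1 \<le> n" using n0[OF n] by auto
    have u0_pos: "0 < u n 0" using u0 c by linarith
    have low: "k * u n 0 powr (- q) \<le> f s" if s: "(1 - x1 / z) * u n 0 \<le> s" "s \<le> u n 0" for s
    proof -
      have "\<eta> / z * c \<le> \<eta> / z * u n 0" using \<eta>z u0 by (intro mult_left_mono) auto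
      then have "\<eta> / z * c \<le> s" using s ratio by simp
      with k(2) have "k * s powr (- q) \<le> f s" .
      moreover have "0 < s" using \<open>\<eta> / z * c \<le> s\<close> \<open>0 < \<eta> / z * c\<close> by linarith
      then have "k * u n 0 powr (- q) \<le> k * s powr (- q)"
        using s k(1) \<open>0 < q\<close> by (intro mult_left_mono powr_mono2') auto
      ultimately show ?thesis by linarith
    qed
    have nonneg: "0 \<le> u n t" if "t \<in> {0..1}" for t
      using assms(23)[OF \<open>1 \<le> n\<close>] that by (auto simp: positive_on_unit_def)
    have f_nonneg: "0 \<le> f s" if "0 \<le> s" for s
      using assms(8) assms(9)[of s] that by (cases "s = 0") simp_all
    note est = regular_solution_estimate[OF assms(22)[OF \<open>1 \<le> n\<close>] nonneg less_imp_le[OF lam]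
        \<open>z < 1\<close> assms(5) f_nonneg x ai low]
    have "lam n * (k * u n 0 powr (- q)) * A < 1"
      using est(2) by (simp add: A_def)
    \<comment> \<open>Multiply by \<open>u n 0 powr q\<close>; the unknown size of \<open>u n 0\<close> is now on one side only.\<close>
    then have "k * A * lam n < u n 0 powr q"
      using u0_pos by (simp add: powr_minus field_simps)
    then have "(k * A * lam n) powr (1 / q) \<le> (u n 0 powr q) powr (1 / q)"
      using k A lam \<open>0 < q\<close> by (intro powr_mono2) auto
    also have "\<dots> = u n 0" using u0_pos \<open>0 < q\<close> by (simp add: powr_powr)
    finally have "(k * A) powr (1 / q) * lam n powr (1 / q) \<le> u n 0"
      using k A lam by (simp add: powr_mult)
    then have "\<eta> / z * ((k * A) powr (1 / q) * lam n powr (1 / q)) \<le> \<eta> / z * u n 0"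
      using \<eta>z by (intro mult_left_mono) auto
    also have "\<dots> \<le> u n x" using est(1)[of x] xr by (simp add: ratio x1_def[symmetric])
    finally show ?thesis by (simp add: mult.assoc)
  qed
  moreover have "0 < ?C" using \<eta>z k A by (intro mult_pos_pos) auto
  moreover have "1 \<le> n0" using n0[of n0] by simp
  ultimately show "\<exists>C>0. \<exists>n0\<ge>1. \<forall>n\<ge>n0. \<forall>x\<in>{0..z - \<eta>}. C * lam n powr (1 / q) \<le> u n x"
    by blast
qed

end
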